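(* Let $X$ be a complex Hilbert space, let $T\colon X\to X$ be a contraction (i.e. $\Vert T\Vert\leq 1$) and assume that $T$ is a Ritt operator. Then for any real numbers $\alpha>-1$ and $\beta\in(-1,3)$ such that $m=\frac{\alpha+\beta}{2}$ is a nonnegative integer, and for any complex Banach space $Y$, a bounded operator $C\colon X\to Y$ is $\alpha$-admissible for $T$ if and only if there exists a constant $K\geq 0$ such that $$\bigl(1-\vert\omega\vert^2\bigr)^{\frac{1+\beta}{2}}\bigl\Vert C(I-\omega T)^{-(m+1)}\bigr\Vert\leq K,\qquad \omega\in\mathbb{D}.$$
   Context: $\mathbb{D}=\{\omega\in\mathbb{C}: |\omega|<1\}$. A bounded operator $T\colon X\to X$ is power bounded if $\sup_{k\geq 0}\Vert T^k\Vert<\infty$. A power bounded operator $T$ is called a Ritt operator if there is a constant $c_1\ge 0$ with $k\Vert T^k-T^{k-1}\Vert\leq c_1$ for all integers $k\geq 1$. For a power bounded $T\colon X\to X$ and real $\alpha>-1$, a bounded operator $C\colon X\to Y$ is called $\alpha$-admissible for $T$ if there is a constant $M\geq 0$ such that $\sum_{k=0}^{\infty}(k+1)^{\alpha}\Vert CT^k(x)\Vert^2\leq M^2\Vert x\Vert^2$ for all $x\in X$. *)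

theory Defs
  imports "HOL-Analysis.Analysis"
begin

class complex_vector = real_vector +
  fixes scaleC :: "complex \<Rightarrow> 'a \<Rightarrow> 'a" (infixr "*\<^sub>C" 75)
  assumes scaleC_add_right: "c *\<^sub>C (x + y) = c *\<^sub>C x + c *\<^sub>C y"
    and scaleC_add_left: "(c + d) *\<^sub>C x = c *\<^sub>C x + d *\<^sub>C x"
    and scaleC_scaleC: "c *\<^sub>C d *\<^sub>C x = (c * d) *\<^sub>C x"
    and scaleC_one: "1 *\<^sub>C x = x"
    and scaleR_scaleC: "r *\<^sub>R x = complex_of_real r *\<^sub>C x"

class complex_normed_vector = complex_vector + real_normed_vector +
  assumes norm_scaleC: "norm (c *\<^sub>C x) = cmod c * norm x"

class complex_banach = complex_normed_vector + banach

text \<open>The inner product is linear in the first argument; its values on the diagonal are real by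
  conjugate symmetry, so taking the real part there loses nothing.\<close>

class complex_inner = complex_normed_vector +
  fixes cinner :: "'a \<Rightarrow> 'a \<Rightarrow> complex"
  assumes cinner_commute: "cinner x y = cnj (cinner y x)"
    and cinner_add_left: "cinner (x + y) z = cinner x z + cinner y z"
    and cinner_scaleC_left: "cinner (c *\<^sub>C x) y = c * cinner x y"
    and cinner_ge_zero: "0 \<le> Re (cinner x x)"
    and cinner_eq_zero_iff: "cinner x x = 0 \<longleftrightarrow> x = 0"
    and norm_eq_sqrt_cinner: "norm x = sqrt (Re (cinner x x))"

class complex_hilbert = complex_inner + complex_banach

instantiation complex :: complex_hilbert
begin

definition scaleC_complex :: "complex \<Rightarrow> complex \<Rightarrow> complex"
  where "scaleC_complex c x = c * x"

definition cinner_complex :: "complex \<Rightarrow> complex \<Rightarrow> complex"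
  where "cinner_complex x y = x * cnj y"

instance
proof
  fix c d x y z :: complex and r :: real
  show "c *\<^sub>C (x + y) = c *\<^sub>C x + c *\<^sub>C y" "(c + d) *\<^sub>C x = c *\<^sub>C x + d *\<^sub>C x"
    by (simp_all add: scaleC_complex_def distrib_left distrib_right)
  show "c *\<^sub>C d *\<^sub>C x = (c * d) *\<^sub>C x" "1 *\<^sub>C x = x"
    by (simp_all add: scaleC_complex_def)
  show "r *\<^sub>R x = complex_of_real r *\<^sub>C x"
    by (simp add: scaleC_complex_def scaleR_conv_of_real)
  show "norm (c *\<^sub>C x) = cmod c * norm x"
    by (simp add: scaleC_complex_def norm_mult)
  show "cinner x y = cnj (cinner y x)"
    by (simp add: cinner_complex_def)
  show "cinner (x + y) z = cinner x z + cinner y z"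
    by (simp add: cinner_complex_def distrib_right)
  show "cinner (c *\<^sub>C x) y = c * cinner x y"
    by (simp add: cinner_complex_def scaleC_complex_def)
  show "0 \<le> Re (cinner x x)" "cinner x x = 0 \<longleftrightarrow> x = 0"
    by (simp_all add: cinner_complex_def)
  show "norm x = sqrt (Re (cinner x x))"
    by (simp add: cinner_complex_def cmod_def power2_eq_square)
qed

end

definition bounded_clinear :: "('a::complex_normed_vector \<Rightarrow> 'b::complex_normed_vector) \<Rightarrow> bool"
  where "bounded_clinear f \<longleftrightarrow> bounded_linear f \<and> (\<forall>c x. f (c *\<^sub>C x) = c *\<^sub>C f x)"

definition power_bounded :: "('a::complex_normed_vector \<Rightarrow> 'a) \<Rightarrow> bool"
  where "power_bounded T \<longleftrightarrow> bounded_clinear T \<and> bdd_above (range (\<lambda>k. onorm (T ^^ k)))"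

definition Ritt :: "('a::complex_normed_vector \<Rightarrow> 'a) \<Rightarrow> bool"
  where "Ritt T \<longleftrightarrow> power_bounded T \<and>
    (\<exists>c\<^sub>1\<ge>0. \<forall>k\<ge>1. real k * onorm (\<lambda>x. (T ^^ k) x - (T ^^ (k - 1)) x) \<le> c\<^sub>1)"

definition admissible ::
    "real \<Rightarrow> ('a::complex_normed_vector \<Rightarrow> 'a) \<Rightarrow> ('a \<Rightarrow> 'b::complex_normed_vector) \<Rightarrow> bool"
  where "admissible \<alpha> T C \<longleftrightarrow> (\<exists>M\<ge>0. \<forall>x.
    summable (\<lambda>k. (real k + 1) powr \<alpha> * (norm (C ((T ^^ k) x)))\<^sup>2) \<and>
    (\<Sum>k. (real k + 1) powr \<alpha> * (norm (C ((T ^^ k) x)))\<^sup>2) \<le> M\<^sup>2 * (norm x)\<^sup>2)"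

text \<open>\<open>(I - \<omega>T)\<^sup>-\<^sup>1\<close>. As \<open>inv\<close> is a choice function, this is meaningful only when \<open>I - \<omega>T\<close> is
  bijective; for power bounded \<open>T\<close> on a Banach space and \<open>\<bar>\<omega>\<bar> < 1\<close> that follows from the Neumann
  series (and the inverse is then bounded).\<close>

definition resolvent_inv :: "('a::complex_normed_vector \<Rightarrow> 'a) \<Rightarrow> complex \<Rightarrow> 'a \<Rightarrow> 'a"
  where "resolvent_inv T \<omega> = inv (\<lambda>x. x - \<omega> *\<^sub>C T x)"

end

theory Submission
  imports Defs
begin

text \<open>
  The resolvent bound follows from admissibility by Cauchy-Schwarz in the power series of
  \<open>(I - \<omega>T)\<^bsup>-(m+1)\<^esup>\<close>, because \<open>2m - \<alpha> = \<beta> > -1\<close>.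

  For the converse put \<open>A = I - T\<close>, \<open>J\<^sub>j = (I + 2\<^sup>j A)\<^sup>-\<^sup>1\<close>, \<open>D\<^sub>j = J\<^sub>j - J\<^sub>j\<^sub>+\<^sub>1\<close> and
  \<open>q = 2\<^bsup>-(1+\<alpha>)/2\<^esup>\<close>. At real \<open>\<omega>\<close> the hypothesis reads \<open>\<parallel>C J\<^sub>j\<^bsup>m+1\<^esup>\<parallel> \<le> K q\<^sup>j\<close>. As
  \<open>A\<close> is accretive, \<open>\<parallel>D\<^sub>j x\<parallel>\<^sup>2 \<le> \<parallel>J\<^sub>j x\<parallel>\<^sup>2 - \<parallel>J\<^sub>j\<^sub>+\<^sub>1 x\<parallel>\<^sup>2\<close>, so telescoping gives the square function
  estimate \<open>\<Sum>\<^sub>j \<parallel>D\<^sub>j x\<parallel>\<^sup>2 \<le> \<parallel>x\<parallel>\<^sup>2\<close>. With \<open>n = 2m + 2\<close>, the difference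
  \<open>J\<^sub>j\<^sup>n - J\<^sub>j\<^sub>+\<^sub>1\<^sup>n\<close> is a sum of products of \<open>D\<^sub>j\<close> with \<open>n - 1 = 2m + 1\<close> resolvents, at least
  \<open>m + 1\<close> of which are equal; hence \<open>\<parallel>C J\<^sub>i\<^sup>n y\<parallel> \<le> n K \<Sum>\<^sub>j\<^sub>\<ge>\<^sub>i q\<^sup>j \<parallel>D\<^sub>j y\<parallel>\<close>. For
  \<open>2\<^sup>i \<le> k + 1 < 2\<^bsup>i+1\<^esup>\<close> the Ritt condition bounds \<open>(I + 2\<^sup>i A)\<^sup>n T\<^sup>k\<close> uniformly, so
  \<open>y = (I + 2\<^sup>i A)\<^sup>n T\<^sup>k x\<close> yields \<open>\<parallel>C T\<^sup>k x\<parallel> \<le> B \<Sum>\<^sub>j\<^sub>\<ge>\<^sub>i q\<^sup>j \<parallel>D\<^sub>j x\<parallel>\<close>, and Schur's test sums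
  the squares over the dyadic blocks.
\<close>

section \<open>Weighted geometric series\<close>

text \<open>The binomial series of (1 - r) powr (-(b + 1)) has the coefficients \<open>p k\<close>
  below, which grow like (k + 1) powr b. It therefore suffices to dominate (k + 1) powr b by a
  multiple of \<open>p k\<close>; for b > -1 all \<open>p k\<close> are positive.\<close>

lemma powr_geometric_suminf_bound:
  fixes b :: real
  assumes "b > -1"
  obtains c where "c > 0"
    and "\<And>r. 0 \<le> r \<Longrightarrow> r < 1 \<Longrightarrow> summable (\<lambda>k. (real k + 1) powr b * r ^ k)"
    and "\<And>r. 0 \<le> r \<Longrightarrow> r < 1 \<Longrightarrow>
      (\<Sum>k. (real k + 1) powr b * r ^ k) \<le> c * (1 - r) powr (- (b + 1))"
proof -
  define p where "p k = pochhammer (b + 1) k / fact k" for k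
  have p_pos: "p k > 0" for k
    unfolding p_def using assms by (intro divide_pos_pos pochhammer_pos) auto
  \<comment> \<open>Gamma's limit formula supplies the comparison: at index n + 1 the term of
    \<open>Gamma_series'\<close> is (n + 1) powr b / \<open>p (Suc n)\<close>, and a convergent
    sequence is bounded. Passing from \<open>p (Suc n)\<close> to \<open>p n\<close> costs at most
    the factor 1 + |b|.\<close>
  have "convergent (Gamma_series' (b + 1))"
    using Gamma_series'_LIMSEQ[of "b + 1"] by (auto simp: convergent_def)
  then have "Bseq (Gamma_series' (b + 1))"
    by (rule convergent_imp_Bseq)
  then obtain B where "B > 0" and B: "\<And>n. norm (Gamma_series' (b + 1) n) \<le> B"
    by (auto simp: Bseq_def)
  have coeff: "(real n + 1) powr b \<le> B * (1 + \<bar>b\<bar>) * p n" for n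
  proof -
    have "Gamma_series' (b + 1) (Suc n) = (real n + 1) powr b / p (Suc n)"
      using p_pos[of "Suc n"]
      by (simp add: Gamma_series'_def p_def powr_def exp_add distrib_right add.commute mult.commute)
    then have "(real n + 1) powr b \<le> B * p (Suc n)"
      using B[of "Suc n"] p_pos[of "Suc n"] by (simp add: pos_divide_le_eq)
    also have "p (Suc n) = (b + 1 + real n) / (real n + 1) * p n"
      by (simp add: p_def pochhammer_Suc field_simps)
    also have "B * \<dots> \<le> B * ((1 + \<bar>b\<bar>) * p n)"
    proof (intro mult_left_mono mult_right_mono)
      have "b \<le> \<bar>b\<bar> * (real n + 1)"
        using mult_left_mono[of 1 "real n + 1" "\<bar>b\<bar>"] by simp
      then show "(b + 1 + real n) / (real n + 1) \<le> 1 + \<bar>b\<bar>"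
        by (simp add: field_simps)
    qed (use \<open>B > 0\<close> p_pos[of n] in auto)
    finally show ?thesis by (simp add: mult.assoc)
  qed
  have main: "summable (\<lambda>k. (real k + 1) powr b * r ^ k) \<and>
      (\<Sum>k. (real k + 1) powr b * r ^ k) \<le> B * (1 + \<bar>b\<bar>) * (1 - r) powr (- (b + 1))"
    if "0 \<le> r" "r < 1" for r
  proof -
    have "(\<lambda>n. (- (b + 1) gchoose n) * (- r) ^ n) sums (1 + (- r)) powr (- (b + 1))"
      using that by (intro gen_binomial_real) auto
    moreover have "(- (b + 1) gchoose n) * (- r) ^ n = p n * r ^ n" for n
    proof -
      have "(- r) ^ n = (- 1) ^ n * r ^ n" by (rule power_minus)
      then show ?thesis by (simp add: gbinomial_pochhammer p_def add.commute)
    qed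
    ultimately have "(\<lambda>n. p n * r ^ n) sums (1 - r) powr (- (b + 1))" by simp
    then have s: "(\<lambda>n. B * (1 + \<bar>b\<bar>) * (p n * r ^ n)) sums (B * (1 + \<bar>b\<bar>) * (1 - r) powr (- (b + 1)))"
      by (rule sums_mult)
    have le: "(real n + 1) powr b * r ^ n \<le> B * (1 + \<bar>b\<bar>) * (p n * r ^ n)" for n
      using mult_right_mono[OF coeff[of n], of "r ^ n"] that by (simp add: mult.assoc)
    have sm: "summable (\<lambda>k. (real k + 1) powr b * r ^ k)"
      by (rule summable_comparison_test'[OF sums_summable[OF s], of 0]) (use le that in auto)
    show ?thesis
      using suminf_le[OF le sm sums_summable[OF s]] sums_unique[OF s] sm by simp
  qed
  show thesis
    by (rule that[of "B * (1 + \<bar>b\<bar>)"]) (use main \<open>B > 0\<close> in auto)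
qed

text \<open>Induction through (m + 1) C(k + m + 1, m + 1) = (k + m + 1) C(k + m, m) and k + m + 1
  \<le> (m + 1)(k + 1). The bound controls the coefficients of the power series of (1 - z)^(-(m +
  1)).\<close>

lemma binomial_le_powr: "real (k + m choose m) \<le> (real k + 1) powr real m"
proof (induction m)
  case (Suc m)
  have "real (Suc m) * real (k + Suc m choose Suc m) = real (k + Suc m) * real (k + m choose m)"
    using Suc_times_binomial_eq[of "k + m" m] by (metis add_Suc_right mult.commute of_nat_mult)
  also have "\<dots> \<le> (real (Suc m) * (real k + 1)) * (real k + 1) powr real m"
    by (intro mult_mono Suc.IH) (auto simp: algebra_simps)
  finally have "real (k + Suc m choose Suc m) \<le> (real k + 1) * (real k + 1) powr real m"
    by (simp only: mult.assoc mult_le_cancel_left_pos of_nat_0_less_iff zero_less_Suc)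
  then show ?case by (simp add: powr_add powr_realpow)
qed simp

section \<open>Dyadic blocks and Schur's test\<close>

lemma sum_split_powers_of_2:
  fixes f :: "nat \<Rightarrow> 'a::comm_monoid_add"
  shows "(\<Sum>k<2 ^ I - 1. f k) = (\<Sum>i<I. \<Sum>k=2 ^ i - 1..<2 ^ Suc i - 1. f k)"
proof (induction I)
  case (Suc I)
  have "sum f {0..<2 ^ I - 1} + sum f {2 ^ I - 1..<2 ^ Suc I - 1} = sum f {0..<2 ^ Suc I - 1}"
    by (intro sum.atLeastLessThan_concat diff_le_mono) auto
  then show ?case
    using Suc by (simp add: atLeast0LessThan)
qed simp

lemma geometric_sum_le:
  fixes q :: real
  assumes "0 < q" "q < 1"
  shows "(\<Sum>j=i..<N. q ^ (j - i)) \<le> 1 / (1 - q)"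
proof -
  have "(\<Sum>j=i..<N. q ^ (j - i)) = (\<Sum>j<N - i. q ^ j)"
    by (rule sum.reindex_bij_witness[of _ "\<lambda>j. j + i" "\<lambda>j. j - i"]) auto
  also have "\<dots> \<le> (\<Sum>j. q ^ j)"
    using assms by (intro sum_le_suminf summable_geometric) auto
  also have "\<dots> = 1 / (1 - q)"
    using assms by (intro suminf_geometric) auto
  finally show ?thesis .
qed

text \<open>Schur's test for the upper triangular kernel q^(j - i), whose row sums and column sums
  are all at most 1 / (1 - q). Each of the two contributes one factor of the constant.\<close>

lemma schur_geometric:
  fixes q :: real and a :: "nat \<Rightarrow> real"
  assumes q: "0 < q" "q < 1"
  shows "(\<Sum>i<N. (\<Sum>j=i..<N. q ^ (j - i) * a j)\<^sup>2) \<le> (\<Sum>j<N. (a j)\<^sup>2) / (1 - q)\<^sup>2"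
proof -
  have row: "(\<Sum>j=i..<N. q ^ (j - i) * a j)\<^sup>2 \<le> 1 / (1 - q) * (\<Sum>j=i..<N. q ^ (j - i) * (a j)\<^sup>2)" for i
  proof -
    \<comment> \<open>The kernel is split into two square roots, so that Cauchy-Schwarz leaves one
      row sum and one sum in which \<open>a j\<close> is squared.\<close>
    have "(\<Sum>j=i..<N. q ^ (j - i) * a j)\<^sup>2 =
        (\<Sum>j=i..<N. sqrt (q ^ (j - i)) * (sqrt (q ^ (j - i)) * a j))\<^sup>2"
      using q by (simp add: mult.assoc[symmetric])
    also have "\<dots> \<le> (\<Sum>j=i..<N. (sqrt (q ^ (j - i)))\<^sup>2) * (\<Sum>j=i..<N. (sqrt (q ^ (j - i)) * a j)\<^sup>2)"
      by (rule Cauchy_Schwarz_ineq_sum)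
    also have "\<dots> = (\<Sum>j=i..<N. q ^ (j - i)) * (\<Sum>j=i..<N. q ^ (j - i) * (a j)\<^sup>2)"
      using q by (simp add: power_mult_distrib)
    also have "\<dots> \<le> 1 / (1 - q) * (\<Sum>j=i..<N. q ^ (j - i) * (a j)\<^sup>2)"
      using q by (intro mult_right_mono geometric_sum_le sum_nonneg) auto
    finally show ?thesis .
  qed
  have col: "(\<Sum>i\<le>j. q ^ (j - i)) \<le> 1 / (1 - q)" for j
  proof -
    have "(\<Sum>i\<le>j. q ^ (j - i)) = (\<Sum>i=0..<Suc j. q ^ (i - 0))"
      by (rule sum.reindex_bij_witness[of _ "\<lambda>i. j - i" "\<lambda>i. j - i"]) auto
    then show ?thesis using geometric_sum_le[OF q, of 0 "Suc j"] by simp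
  qed
  have "(\<Sum>i<N. (\<Sum>j=i..<N. q ^ (j - i) * a j)\<^sup>2) \<le>
      (\<Sum>i<N. 1 / (1 - q) * (\<Sum>j=i..<N. q ^ (j - i) * (a j)\<^sup>2))"
    by (intro sum_mono row)
  also have "\<dots> = 1 / (1 - q) * (\<Sum>i\<in>{..<N}. \<Sum>j\<in>{j\<in>{..<N}. i \<le> j}. q ^ (j - i) * (a j)\<^sup>2)"
    unfolding sum_distrib_left[symmetric]
    by (intro arg_cong[where f = "(*) _"] sum.cong) auto
  also have "\<dots> = 1 / (1 - q) * (\<Sum>j\<in>{..<N}. \<Sum>i\<in>{i\<in>{..<N}. i \<le> j}. q ^ (j - i) * (a j)\<^sup>2)"
    by (subst sum.swap_restrict) auto
  also have "\<dots> = 1 / (1 - q) * (\<Sum>j<N. (\<Sum>i\<le>j. q ^ (j - i)) * (a j)\<^sup>2)"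
    unfolding sum_distrib_right
    by (intro arg_cong[where f = "(*) _"] sum.cong) auto
  also have "\<dots> \<le> 1 / (1 - q) * (\<Sum>j<N. 1 / (1 - q) * (a j)\<^sup>2)"
    using q by (intro mult_left_mono sum_mono mult_right_mono col) auto
  also have "\<dots> = (\<Sum>j<N. (a j)\<^sup>2) / (1 - q)\<^sup>2"
    by (simp add: sum_divide_distrib[symmetric] power2_eq_square)
  finally show ?thesis .
qed

text \<open>Block i consists of the 2^i indices with 2^i \<le> k + 1 < 2^(i + 1). On it (k + 1) /
  2^i lies in [1, 2], so its power \<alpha> is at most 2 powr |\<alpha>| for either sign of
  \<alpha>.\<close>

lemma dyadic_block_powr_sum_le:
  fixes \<alpha> :: real
  shows "(\<Sum>k=2 ^ i - 1..<2 ^ Suc i - 1. (real k + 1) powr \<alpha>) \<le> 2 powr \<bar>\<alpha>\<bar> * (2 powr (1 + \<alpha>)) ^ i"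
proof -
  have "(real k + 1) powr \<alpha> \<le> 2 powr \<bar>\<alpha>\<bar> * (2 ^ i) powr \<alpha>"
    if k: "k \<in> {2 ^ i - 1..<2 ^ Suc i - 1}" for k :: nat
  proof -
    have "2 ^ i \<le> k + 1" "k + 1 \<le> 2 * 2 ^ i" using k by auto
    then have "real (2 ^ i) \<le> real (k + 1)" "real (k + 1) \<le> real (2 * 2 ^ i)"
      by (simp_all only: of_nat_le_iff)
    then have u: "1 \<le> (real k + 1) / 2 ^ i" "(real k + 1) / 2 ^ i \<le> 2"
      by (simp_all add: field_simps)
    have "(real k + 1) powr \<alpha> = ((real k + 1) / 2 ^ i) powr \<alpha> * (2 ^ i) powr \<alpha>"
      by (subst powr_mult[symmetric]) auto
    also have "((real k + 1) / 2 ^ i) powr \<alpha> \<le> ((real k + 1) / 2 ^ i) powr \<bar>\<alpha>\<bar>"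
      using u by (intro powr_mono) auto
    also have "\<dots> \<le> 2 powr \<bar>\<alpha>\<bar>"
      using u by (intro powr_mono2) auto
    finally show ?thesis by (simp add: mult_right_mono)
  qed
  then have "(\<Sum>k=2 ^ i - 1..<2 ^ Suc i - 1. (real k + 1) powr \<alpha>) \<le>
      real (card {2 ^ i - 1..<2 ^ Suc i - 1 :: nat}) * (2 powr \<bar>\<alpha>\<bar> * (2 ^ i) powr \<alpha>)"
    by (rule sum_bounded_above)
  also have "card {2 ^ i - 1..<2 ^ Suc i - 1 :: nat} = 2 ^ i" by simp
  also have "(2 ^ i) powr \<alpha> = (2 powr \<alpha> :: real) ^ i"
    by (simp add: powr_realpow[symmetric] powr_powr powr_power mult.commute)
  finally show ?thesis
    by (simp add: powr_add power_mult_distrib ac_simps)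
qed

text \<open>To be applied with \<open>v k\<close> the norm of C T^k x, \<open>a j\<close> the norm
  of \<open>D j x\<close>, \<open>r\<close> the norm of x and \<open>Q\<close> its square. On block
  i the weight (2 powr (1 + \<alpha>))^i cancels q^(2 i), which leaves the sums of
  \<open>schur_geometric\<close>.\<close>

lemma dyadic_weighted_sum_bound:
  fixes a v :: "nat \<Rightarrow> real" and \<alpha> B r :: real
  assumes "\<alpha> > -1"
  defines "q \<equiv> 2 powr (- (1 + \<alpha>) / 2)"
  assumes a: "\<And>N. (\<Sum>j<N. (a j)\<^sup>2) \<le> Q"
    and v_nonneg: "\<And>k. 0 \<le> v k"
    and v_le: "\<And>k i N. 2 ^ i \<le> real k + 1 \<Longrightarrow> i \<le> N \<Longrightarrow>
      v k \<le> B * (\<Sum>j=i..<N. q ^ j * a j) + B * q ^ N * r"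
  shows "(\<Sum>k<n. (real k + 1) powr \<alpha> * (v k)\<^sup>2) \<le> 2 powr \<bar>\<alpha>\<bar> * (2 * B\<^sup>2) * (Q / (1 - q)\<^sup>2)"
proof -
  let ?A = "2 powr \<bar>\<alpha>\<bar>"
  define p where "p = 2 powr (1 + \<alpha>)"
  have q: "0 < q" "q < 1"
    unfolding q_def using assms(1) by (auto simp: powr_less_one)
  have pq: "p * q\<^sup>2 = 1"
    unfolding p_def q_def by (simp add: power2_eq_square powr_add[symmetric])
  have "0 < p" by (simp add: p_def)
  \<comment> \<open>\<open>I\<close> counts the blocks; n of them cover all indices below n because
    n \<le> 2^n - 1.\<close>
  define I where "I = n"
  define W where "W = (\<Sum>k<2 ^ I - 1. (real k + 1) powr \<alpha> * (v k)\<^sup>2)"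
  have W_le: "W \<le> ?A * (2 * B\<^sup>2) * (Q / (1 - q)\<^sup>2) + (\<Sum>i<I. ?A * p ^ i * (2 * (B * q ^ N * r)\<^sup>2))"
    if "I \<le> N" for N
  proof -
    define S where "S i = (\<Sum>j=i..<N. q ^ j * a j)" for i
    have block: "(\<Sum>k=2 ^ i - 1..<2 ^ Suc i - 1. (real k + 1) powr \<alpha> * (v k)\<^sup>2) \<le>
        ?A * p ^ i * (2 * B\<^sup>2 * (S i)\<^sup>2 + 2 * (B * q ^ N * r)\<^sup>2)" if "i < I" for i
    proof -
      have vk: "(v k)\<^sup>2 \<le> 2 * B\<^sup>2 * (S i)\<^sup>2 + 2 * (B * q ^ N * r)\<^sup>2"
        if "k \<in> {2 ^ i - 1..<2 ^ Suc i - 1}" for k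
      proof -
        have "2 ^ i \<le> k + 1" using that by auto
        then have "real (2 ^ i) \<le> real (k + 1)" by (simp only: of_nat_le_iff)
        then have "v k \<le> B * S i + B * q ^ N * r"
          unfolding S_def using \<open>i < I\<close> \<open>I \<le> N\<close> by (intro v_le) auto
        then have "(v k)\<^sup>2 \<le> (B * S i + B * q ^ N * r)\<^sup>2"
          by (intro power_mono v_nonneg)
        also have "\<dots> \<le> 2 * (B * S i)\<^sup>2 + 2 * (B * q ^ N * r)\<^sup>2"
          using sum_squares_ge_zero[of "B * S i - B * q ^ N * r" 0]
          by (simp add: power2_eq_square algebra_simps)
        finally show ?thesis by (simp add: power_mult_distrib)
      qed
      have "(\<Sum>k=2 ^ i - 1..<2 ^ Suc i - 1. (real k + 1) powr \<alpha> * (v k)\<^sup>2) \<le>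
          (\<Sum>k=2 ^ i - 1..<2 ^ Suc i - 1. (real k + 1) powr \<alpha> * (2 * B\<^sup>2 * (S i)\<^sup>2 + 2 * (B * q ^ N * r)\<^sup>2))"
        by (intro sum_mono mult_left_mono vk) auto
      also have "\<dots> = (\<Sum>k=2 ^ i - 1..<2 ^ Suc i - 1. (real k + 1) powr \<alpha>) *
          (2 * B\<^sup>2 * (S i)\<^sup>2 + 2 * (B * q ^ N * r)\<^sup>2)"
        by (rule sum_distrib_right[symmetric])
      also have "\<dots> \<le> ?A * p ^ i * (2 * B\<^sup>2 * (S i)\<^sup>2 + 2 * (B * q ^ N * r)\<^sup>2)"
        unfolding p_def by (intro mult_right_mono dyadic_block_powr_sum_le) auto
      finally show ?thesis .
    qed
    have scaled: "p ^ i * (S i)\<^sup>2 = (\<Sum>j=i..<N. q ^ (j - i) * a j)\<^sup>2" for i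
    proof -
      have "S i = q ^ i * (\<Sum>j=i..<N. q ^ (j - i) * a j)"
        unfolding S_def sum_distrib_left
        by (intro sum.cong) (auto simp: mult.assoc[symmetric] power_add[symmetric])
      moreover have "p ^ i * (q ^ i)\<^sup>2 = 1"
        by (metis pq power_mult_distrib power_one power_mult mult.commute)
      ultimately show ?thesis
        by (simp add: power_mult_distrib mult.assoc[symmetric])
    qed
    have "(\<Sum>i<I. p ^ i * (S i)\<^sup>2) \<le> (\<Sum>i<N. p ^ i * (S i)\<^sup>2)"
      using \<open>I \<le> N\<close> \<open>0 < p\<close> by (intro sum_mono2) auto
    also have "\<dots> \<le> (\<Sum>j<N. (a j)\<^sup>2) / (1 - q)\<^sup>2"
      unfolding scaled by (rule schur_geometric[OF q])
    also have "\<dots> \<le> Q / (1 - q)\<^sup>2"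
      by (intro divide_right_mono a) simp
    finally have S: "(\<Sum>i<I. p ^ i * (S i)\<^sup>2) \<le> Q / (1 - q)\<^sup>2" .
    have "W \<le> (\<Sum>i<I. ?A * p ^ i * (2 * B\<^sup>2 * (S i)\<^sup>2 + 2 * (B * q ^ N * r)\<^sup>2))"
      unfolding W_def sum_split_powers_of_2 by (intro sum_mono block) simp
    also have "\<dots> = ?A * (2 * B\<^sup>2) * (\<Sum>i<I. p ^ i * (S i)\<^sup>2) + (\<Sum>i<I. ?A * p ^ i * (2 * (B * q ^ N * r)\<^sup>2))"
      by (simp add: sum.distrib sum_distrib_left distrib_left ac_simps)
    also have "?A * (2 * B\<^sup>2) * (\<Sum>i<I. p ^ i * (S i)\<^sup>2) \<le> ?A * (2 * B\<^sup>2) * (Q / (1 - q)\<^sup>2)"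
      by (intro mult_left_mono S) auto
    finally show ?thesis by simp
  qed
  \<comment> \<open>The number of blocks stays fixed while the truncation index N tends to infinity,
    so the remainders containing q^N disappear.\<close>
  have "(\<lambda>N. q ^ N) \<longlonglongrightarrow> 0"
    using q by (intro LIMSEQ_realpow_zero) auto
  then have "(\<lambda>N. ?A * (2 * B\<^sup>2) * (Q / (1 - q)\<^sup>2) + (\<Sum>i<I. ?A * p ^ i * (2 * (B * q ^ N * r)\<^sup>2))) \<longlonglongrightarrow>
      ?A * (2 * B\<^sup>2) * (Q / (1 - q)\<^sup>2) + (\<Sum>i<I. ?A * p ^ i * (2 * (B * 0 * r)\<^sup>2))"
    by (intro tendsto_add tendsto_const tendsto_sum tendsto_mult tendsto_power)
  then have "W \<le> ?A * (2 * B\<^sup>2) * (Q / (1 - q)\<^sup>2) + (\<Sum>i<I. ?A * p ^ i * (2 * (B * 0 * r)\<^sup>2))"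
    by (rule LIMSEQ_le_const) (use W_le in blast)
  moreover have "(\<Sum>k<n. (real k + 1) powr \<alpha> * (v k)\<^sup>2) \<le> W"
  proof -
    have "n \<le> 2 ^ I - 1"
      using less_exp[of n] unfolding I_def by linarith
    then show ?thesis unfolding W_def by (intro sum_mono2) auto
  qed
  ultimately show ?thesis by simp
qed

section \<open>Complex-linear operators\<close>

lemma bounded_linear_scaleC: "bounded_linear (\<lambda>x::'a::complex_normed_vector. c *\<^sub>C x)"
proof (rule bounded_linear_intro[where K = "cmod c"])
  show "c *\<^sub>C (r *\<^sub>R x) = r *\<^sub>R (c *\<^sub>C x)" for r and x :: 'a
    by (simp add: scaleR_scaleC scaleC_scaleC mult.commute)
qed (simp_all add: scaleC_add_right norm_scaleC mult.commute)

lemma scaleC_of_real: "complex_of_real r *\<^sub>C x = r *\<^sub>R (x::'a::complex_vector)"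
  by (simp add: scaleR_scaleC)

lemma bounded_linear_funpow:
  fixes f :: "'a::real_normed_vector \<Rightarrow> 'a"
  assumes "bounded_linear f"
  shows "bounded_linear (f ^^ n)"
proof (induction n)
  case 0
  show ?case by (simp add: id_def bounded_linear_ident)
next
  case (Suc n)
  show ?case using bounded_linear_compose[OF assms Suc] by (simp add: comp_def)
qed

lemma funpow_nonexpansive:
  fixes f :: "'a::real_normed_vector \<Rightarrow> 'a"
  assumes "\<And>x. norm (f x) \<le> norm x"
  shows "norm ((f ^^ n) x) \<le> norm x"
  by (induction n) (auto intro: order_trans[OF assms])

lemma funpow_commute:
  assumes "\<And>x. f (g x) = g (f x)"
  shows "(f ^^ i) (g x) = g ((f ^^ i) x)" and "(f ^^ i) ((g ^^ j) x) = (g ^^ j) ((f ^^ i) x)"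
proof -
  show *: "(f ^^ i) (g x) = g ((f ^^ i) x)" for x
    by (induction i) (simp_all add: assms)
  show "(f ^^ i) ((g ^^ j) x) = (g ^^ j) ((f ^^ i) x)"
    by (induction j) (simp_all add: *)
qed

text \<open>Inductive step: P^(n+1) - Q^(n+1) = P^n (P - Q) + (P^n - Q^n) Q, where commutation lets
  the last Q pass through P - Q and join the powers of Q.\<close>

lemma funpow_diff_telescope:
  fixes P Q :: "'a::real_vector \<Rightarrow> 'a"
  assumes "linear P" "linear Q" and comm: "\<And>x. P (Q x) = Q (P x)"
  shows "(P ^^ n) x - (Q ^^ n) x = (\<Sum>l<n. (P ^^ l) ((Q ^^ (n - 1 - l)) (P x - Q x)))"
proof (induction n arbitrary: x)
  case (Suc n)
  have pw: "linear (P ^^ n)"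
  proof (induction n)
    case (Suc k)
    then show ?case using linear_compose[OF Suc assms(1)] by (simp add: comp_def)
  qed (simp add: id_def linear_id[unfolded id_def])
  have shift: "(Q ^^ (n - 1 - l)) (P (Q x) - Q (Q x)) = (Q ^^ (n - l)) (P x - Q x)" if "l < n" for l
  proof -
    have "P (Q x) - Q (Q x) = Q (P x - Q x)"
      by (simp add: comm linear_diff[OF \<open>linear Q\<close>])
    moreover have "n - l = Suc (n - 1 - l)" using that by simp
    ultimately show ?thesis by (simp only: funpow_Suc_right comp_apply)
  qed
  have "(P ^^ Suc n) x - (Q ^^ Suc n) x =
      (P ^^ n) (P x - Q x) + ((P ^^ n) (Q x) - (Q ^^ n) (Q x))"
    by (simp add: funpow_Suc_right linear_diff[OF pw] del: funpow.simps)
  also have "\<dots> = (\<Sum>l<Suc n. (P ^^ l) ((Q ^^ (n - l)) (P x - Q x)))"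
    unfolding Suc.IH by (simp add: shift[simplified] cong: sum.cong_simp)
  finally show ?case by simp
qed simp

section \<open>Accretivity in a complex inner product space\<close>

lemma norm_add_scaleR_power2:
  fixes x y :: "'a::complex_inner"
  shows "(norm (x + t *\<^sub>R y))\<^sup>2 = (norm x)\<^sup>2 + 2 * t * Re (cinner x y) + t\<^sup>2 * (norm y)\<^sup>2"
proof -
  have sq: "(norm z)\<^sup>2 = Re (cinner z z)" for z :: 'a
    by (simp add: norm_eq_sqrt_cinner cinner_ge_zero)
  have sym: "Re (cinner u v) = Re (cinner v u)" for u v :: 'a
    by (subst cinner_commute) simp
  have add: "Re (cinner (u + v) z) = Re (cinner u z) + Re (cinner v z)" for u v z :: 'a
    by (simp add: cinner_add_left)
  have scale: "Re (cinner (r *\<^sub>R u) v) = r * Re (cinner u v)" for r and u v :: 'a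
    by (simp add: scaleR_scaleC cinner_scaleC_left)
  have "Re (cinner (x + t *\<^sub>R y) (x + t *\<^sub>R y)) =
      Re (cinner x x) + 2 * t * Re (cinner x y) + t\<^sup>2 * Re (cinner y y)"
    using sym[of "x + t *\<^sub>R y" x] sym[of "x + t *\<^sub>R y" y] sym[of y x]
      sym[of x "x + t *\<^sub>R y"] sym[of y "x + t *\<^sub>R y"]
    by (simp add: add scale power2_eq_square algebra_simps)
  then show ?thesis by (simp add: sq)
qed

text \<open>With z = w - T w the first assumption says that T does not increase the norm of w.
  Squared, it makes 2 Re (cinner w z) at least the squared norm of z, so the linear term of the
  quadratic polynomial in t is nondecreasing and only its quadratic term is kept.\<close>

lemma norm_add_scaleR_power2_diff_ge:
  fixes w z :: "'a::complex_inner"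
  assumes "norm (w - z) \<le> norm w" "0 \<le> s" "s \<le> t"
  shows "(t\<^sup>2 - s\<^sup>2) * (norm z)\<^sup>2 \<le> (norm (w + t *\<^sub>R z))\<^sup>2 - (norm (w + s *\<^sub>R z))\<^sup>2"
proof -
  have "(norm (w + (-1) *\<^sub>R z))\<^sup>2 \<le> (norm w)\<^sup>2"
    using assms(1) by (intro power_mono) auto
  then have "(norm z)\<^sup>2 \<le> 2 * Re (cinner w z)"
    unfolding norm_add_scaleR_power2 by simp
  then have "0 \<le> 2 * Re (cinner w z)"
    using zero_le_power2[of "norm z"] by linarith
  then have "0 \<le> (t - s) * (2 * Re (cinner w z))"
    using assms(3) by (intro mult_nonneg_nonneg) auto
  then show ?thesis
    unfolding norm_add_scaleR_power2 by (simp add: algebra_simps)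
qed

section \<open>Resolvents of a contraction\<close>

locale hilbert_contraction =
  fixes T :: "'a::complex_hilbert \<Rightarrow> 'a"
  assumes bounded_clinear: "bounded_clinear T"
    and onorm_le_1: "onorm T \<le> 1"
begin

lemma bounded_linear_T: "bounded_linear T"
  using bounded_clinear by (simp add: bounded_clinear_def)

lemma T_add: "T (x + y) = T x + T y"
  and T_diff: "T (x - y) = T x - T y"
  and T_scaleR: "T (r *\<^sub>R x) = r *\<^sub>R T x"
  using bounded_linear.linear[OF bounded_linear_T]
  by (simp_all add: linear_add linear_diff linear_scale)

lemma T_scaleC: "T (c *\<^sub>C x) = c *\<^sub>C T x"
  using bounded_clinear by (simp add: bounded_clinear_def)

lemma norm_T_le: "norm (T x) \<le> norm x"
  using onorm[OF bounded_linear_T, of x] mult_right_mono[OF onorm_le_1, of "norm x"] by simp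

lemma norm_funpow_T_le: "norm ((T ^^ k) x) \<le> norm x"
  by (rule funpow_nonexpansive) (rule norm_T_le)

section \<open>Inverting I - \<omega>T by Neumann series\<close>

abbreviation shifted :: "complex \<Rightarrow> 'a \<Rightarrow> 'a"
  where "shifted \<omega> x \<equiv> x - \<omega> *\<^sub>C T x"

lemma linear_shifted: "linear (shifted \<omega>)"
  by (intro linear_compose_sub bounded_linear.linear bounded_linear_ident
      bounded_linear_compose[OF bounded_linear_scaleC bounded_linear_T])

lemma norm_shifted_ge: "(1 - cmod \<omega>) * norm x \<le> norm (shifted \<omega> x)"
proof -
  have "norm (\<omega> *\<^sub>C T x) \<le> cmod \<omega> * norm x"
    by (simp add: norm_scaleC mult_left_mono norm_T_le)
  then show ?thesis
    using norm_triangle_ineq2[of x "\<omega> *\<^sub>C T x"] by (simp add: algebra_simps)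
qed

lemma inj_shifted: "cmod \<omega> < 1 \<Longrightarrow> inj (shifted \<omega>)"
  unfolding linear_injective_0[OF linear_shifted]
  by (metis norm_shifted_ge diff_gt_0_iff_gt mult_le_0_iff norm_le_zero_iff norm_zero not_less)

text \<open>The terms of the power series of (I - \<omega>T)^(-(m + 1)) applied to x; the binomial
  coefficients are those of (1 - z)^(-(m + 1)).\<close>

definition neumann :: "nat \<Rightarrow> complex \<Rightarrow> 'a \<Rightarrow> nat \<Rightarrow> 'a"
  where "neumann m \<omega> x k = (of_nat (k + m choose m) * \<omega> ^ k) *\<^sub>C (T ^^ k) x"

lemma summable_neumann:
  assumes "cmod \<omega> < 1"
  shows "summable (neumann m \<omega> x)"
proof -
  have "summable (\<lambda>k. (real k + 1) powr real m * cmod \<omega> ^ k)"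
    by (rule powr_geometric_suminf_bound[of "real m"]) (use assms in auto)
  then have "summable (\<lambda>k. (real k + 1) powr real m * cmod \<omega> ^ k * norm x)"
    by (rule summable_mult2)
  then show ?thesis
  proof (rule summable_comparison_test'[of _ 0])
    fix k
    have "norm (neumann m \<omega> x k) = real (k + m choose m) * cmod \<omega> ^ k * norm ((T ^^ k) x)"
      by (simp add: neumann_def norm_scaleC norm_mult norm_power)
    also have "\<dots> \<le> (real k + 1) powr real m * cmod \<omega> ^ k * norm x"
      by (intro mult_mono binomial_le_powr norm_funpow_T_le) auto
    finally show "norm (neumann m \<omega> x k) \<le> (real k + 1) powr real m * cmod \<omega> ^ k * norm x" .
  qed
qed

text \<open>The operator \<omega>T turns a term with T^k into one with T^(k + 1). The second series
  is therefore shifted by one place, with 0 in front, so that equal powers of T are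
  subtracted.\<close>

lemma shifted_suminf_neumann_sums:
  assumes "cmod \<omega> < 1"
  shows "(\<lambda>k. neumann m \<omega> x k - (case k of 0 \<Rightarrow> 0 | Suc j \<Rightarrow> \<omega> *\<^sub>C T (neumann m \<omega> x j)))
    sums shifted \<omega> (suminf (neumann m \<omega> x))"
proof (rule sums_diff)
  show s: "neumann m \<omega> x sums suminf (neumann m \<omega> x)"
    by (rule summable_sums[OF summable_neumann[OF assms]])
  have "(\<lambda>k. \<omega> *\<^sub>C T (neumann m \<omega> x k)) sums (\<omega> *\<^sub>C T (suminf (neumann m \<omega> x)))"
    using bounded_linear.sums[OF bounded_linear_compose[OF bounded_linear_scaleC bounded_linear_T] s] .
  then show "(\<lambda>k. case k of 0 \<Rightarrow> 0 | Suc j \<Rightarrow> \<omega> *\<^sub>C T (neumann m \<omega> x j))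
      sums (\<omega> *\<^sub>C T (suminf (neumann m \<omega> x)))"
    by (subst sums_Suc_iff[symmetric, where f = "\<lambda>k. case k of 0 \<Rightarrow> 0 | Suc j \<Rightarrow> \<omega> *\<^sub>C T (neumann m \<omega> x j)", simplified]) simp
qed

lemma shifted_suminf_neumann_0:
  assumes "cmod \<omega> < 1"
  shows "shifted \<omega> (suminf (neumann 0 \<omega> x)) = x"
proof -
  have "(\<lambda>k. neumann 0 \<omega> x k - (case k of 0 \<Rightarrow> 0 | Suc j \<Rightarrow> \<omega> *\<^sub>C T (neumann 0 \<omega> x j))) =
      (\<lambda>k. if k = 0 then x else 0)"
    by (auto simp: fun_eq_iff neumann_def T_scaleC scaleC_scaleC scaleC_one split: nat.split)
  then show ?thesis
    using sums_unique2[OF shifted_suminf_neumann_sums[OF assms, of 0 x]] sums_single[of 0 "\<lambda>_. x"]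
    by simp
qed

text \<open>By Pascal's rule, applied term by term, each factor I - \<omega>T lowers the order of
  the series by one.\<close>

lemma shifted_suminf_neumann_Suc:
  assumes "cmod \<omega> < 1"
  shows "shifted \<omega> (suminf (neumann (Suc m) \<omega> x)) = suminf (neumann m \<omega> x)"
proof -
  have "neumann (Suc m) \<omega> x k - (case k of 0 \<Rightarrow> 0 | Suc j \<Rightarrow> \<omega> *\<^sub>C T (neumann (Suc m) \<omega> x j)) =
      neumann m \<omega> x k" for k
  proof (cases k)
    case (Suc j)
    have "of_nat (Suc j + Suc m choose Suc m) * \<omega> ^ Suc j =
        of_nat (Suc j + m choose m) * \<omega> ^ Suc j + \<omega> * (of_nat (j + Suc m choose Suc m) * \<omega> ^ j)"
      by (simp add: algebra_simps)
    then show ?thesis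
      by (simp only: Suc neumann_def T_scaleC scaleC_scaleC nat.case funpow.simps comp_apply scaleC_add_left)
        simp
  qed (simp add: neumann_def)
  then show ?thesis
    using sums_unique[OF shifted_suminf_neumann_sums[OF assms, of "Suc m" x]] by simp
qed

text \<open>Makes the \<open>inv\<close> in \<open>resolvent_inv\<close> a genuine two-sided
  inverse: the lower norm bound gives injectivity, the Neumann series a preimage.\<close>

lemma bij_shifted: "cmod \<omega> < 1 \<Longrightarrow> bij (shifted \<omega>)"
  unfolding bij_def surj_def using inj_shifted shifted_suminf_neumann_0 by metis

lemma resolvent_shifted: "cmod \<omega> < 1 \<Longrightarrow> resolvent_inv T \<omega> (shifted \<omega> x) = x"
  unfolding resolvent_inv_def by (rule inv_f_f[OF inj_shifted])

lemma shifted_resolvent: "cmod \<omega> < 1 \<Longrightarrow> shifted \<omega> (resolvent_inv T \<omega> x) = x"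
  unfolding resolvent_inv_def by (rule surj_f_inv_f[OF bij_is_surj[OF bij_shifted]])

lemma funpow_resolvent_eq_suminf_neumann:
  assumes "cmod \<omega> < 1"
  shows "(resolvent_inv T \<omega> ^^ Suc m) x = suminf (neumann m \<omega> x)"
proof (induction m)
  case 0
  then show ?case
    using resolvent_shifted[OF assms] shifted_suminf_neumann_0[OF assms] by simp metis
next
  case (Suc m)
  then show ?case
    using resolvent_shifted[OF assms] shifted_suminf_neumann_Suc[OF assms, of m x] by simp metis
qed

lemma bounded_linear_resolvent:
  assumes "cmod \<omega> < 1"
  shows "bounded_linear (resolvent_inv T \<omega>)"
proof (rule bounded_linear_intro[where K = "1 / (1 - cmod \<omega>)"])
  let ?R = "resolvent_inv T \<omega>"
  have eq: "?R x = y" if "shifted \<omega> y = x" for x y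
    using resolvent_shifted[OF assms] that by blast
  show "?R (x + y) = ?R x + ?R y" for x y
    by (rule eq) (simp only: linear_add[OF linear_shifted] shifted_resolvent[OF assms])
  show "?R (r *\<^sub>R x) = r *\<^sub>R ?R x" for r x
    by (rule eq) (simp only: linear_scale[OF linear_shifted] shifted_resolvent[OF assms])
  show "norm (?R x) \<le> norm x * (1 / (1 - cmod \<omega>))" for x
    using norm_shifted_ge[of \<omega> "?R x"] assms shifted_resolvent[OF assms, of x]
    by (simp add: field_simps)
qed

text \<open>\<open>J s = (I + s (I - T))\<^sup>-\<^sup>1\<close>; the resolvents at real \<open>\<omega> = s / (1 + s)\<close> are all that the
  converse implication uses.\<close>

abbreviation E :: "real \<Rightarrow> 'a \<Rightarrow> 'a"
  where "E s x \<equiv> x + s *\<^sub>R (x - T x)"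

definition J :: "real \<Rightarrow> 'a \<Rightarrow> 'a"
  where "J s x = (1 / (1 + s)) *\<^sub>R resolvent_inv T (complex_of_real (s / (1 + s))) x"

lemma cmod_J_point: "0 \<le> s \<Longrightarrow> cmod (complex_of_real (s / (1 + s))) = s / (1 + s)"
  by (simp only: norm_of_real) simp

lemma cmod_J_point_less: "0 \<le> s \<Longrightarrow> cmod (complex_of_real (s / (1 + s))) < 1"
  by (simp only: cmod_J_point) simp

lemma E_eq_shifted:
  assumes "0 \<le> s"
  shows "E s x = (1 + s) *\<^sub>R shifted (complex_of_real (s / (1 + s))) x"
proof -
  have "(1 + s) *\<^sub>R shifted (complex_of_real (s / (1 + s))) x =
      (1 + s) *\<^sub>R x - ((1 + s) * (s / (1 + s))) *\<^sub>R T x"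
    unfolding scaleC_of_real by (simp only: scaleR_diff_right scaleR_scaleR)
  also have "(1 + s) * (s / (1 + s)) = s" using assms by simp
  finally show ?thesis by (simp add: algebra_simps)
qed

lemma bounded_linear_J: "0 \<le> s \<Longrightarrow> bounded_linear (J s)"
  unfolding J_def
  by (intro bounded_linear_compose[OF bounded_linear_scaleR_right] bounded_linear_resolvent cmod_J_point_less)

lemma J_E:
  assumes "0 \<le> s"
  shows "J s (E s x) = x"
proof -
  have "J s (E s x) = (1 / (1 + s)) *\<^sub>R (1 + s) *\<^sub>R x"
    unfolding E_eq_shifted[OF assms] J_def
      linear_scale[OF bounded_linear.linear[OF bounded_linear_resolvent[OF cmod_J_point_less[OF assms]]]]
      resolvent_shifted[OF cmod_J_point_less[OF assms]] ..
  then show ?thesis using assms by simp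
qed

lemma E_J:
  assumes "0 \<le> s"
  shows "E s (J s x) = x"
proof -
  have "E s (J s x) = (1 + s) *\<^sub>R (1 / (1 + s)) *\<^sub>R x"
    unfolding E_eq_shifted[OF assms] J_def linear_scale[OF linear_shifted]
      shifted_resolvent[OF cmod_J_point_less[OF assms]] ..
  then show ?thesis using assms by simp
qed

text \<open>The lower bound for I - \<omega>T at \<omega> = s / (1 + s), multiplied by 1 + s, has
  constant (1 + s)(1 - s / (1 + s)) = 1. Hence \<open>E s\<close> shrinks no norm and its inverse is
  a contraction.\<close>

lemma norm_J_le:
  assumes "0 \<le> s"
  shows "norm (J s x) \<le> norm x"
proof -
  have "norm y \<le> norm (E s y)" for y
  proof -
    have "norm y = (1 + s) * ((1 - s / (1 + s)) * norm y)"
      using assms by (simp add: field_simps)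
    also have "\<dots> \<le> (1 + s) * norm (shifted (complex_of_real (s / (1 + s))) y)"
      using norm_shifted_ge[of "complex_of_real (s / (1 + s))" y] assms
      unfolding cmod_J_point[OF assms] by (intro mult_left_mono) auto
    also have "\<dots> = norm (E s y)"
      unfolding E_eq_shifted[OF assms] using assms by simp
    finally show ?thesis .
  qed
  from this[of "J s x"] show ?thesis
    by (simp only: E_J[OF assms])
qed

text \<open>What commutes with \<open>E s\<close> commutes with its inverse: apply
  \<open>J s\<close> to \<open>E s (G (J s x))\<close>, which equals \<open>G x\<close>.\<close>

lemma J_commute:
  assumes "0 \<le> s" and "\<And>x. G (E s x) = E s (G x)"
  shows "G (J s x) = J s (G x)"
  using J_E[OF assms(1), of "G (J s x)"] by (simp only: assms(2)[symmetric] E_J[OF assms(1)])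

lemma E_T: "T (E s x) = E s (T x)"
  by (simp add: T_add T_diff T_scaleR)

lemma E_E: "E t (E s x) = E s (E t x)"
  by (simp add: T_add T_diff T_scaleR algebra_simps)

lemma T_J: "0 \<le> s \<Longrightarrow> T (J s x) = J s (T x)"
  by (intro J_commute E_T)

lemma E_J_commute: "0 \<le> s \<Longrightarrow> E t (J s x) = J s (E t x)"
  by (intro J_commute E_E)

lemma J_J: "0 \<le> s \<Longrightarrow> 0 \<le> t \<Longrightarrow> J t (J s x) = J s (J t x)"
  by (intro J_commute E_J_commute[symmetric]) auto

lemma funpow_J:
  assumes "0 \<le> s"
  shows "(J s ^^ n) x =
    (1 / (1 + s)) ^ n *\<^sub>R (resolvent_inv T (complex_of_real (s / (1 + s))) ^^ n) x"
proof (induction n)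
  case (Suc n)
  then show ?case
    by (simp add: J_def linear_scale[OF bounded_linear.linear[OF bounded_linear_resolvent[OF cmod_J_point_less[OF assms]]]]
        del: of_real_divide of_real_add)
qed simp

text \<open>For w = \<open>J s (J t x)\<close> both vectors lie on the ray from w in direction w - T
  w: \<open>J t x\<close> at parameter s and \<open>J s x\<close> at parameter t. Accretivity bounds
  the growth of the squared norm along this ray from below, and (t - s)^2 \<le> t^2 - s^2.\<close>

lemma norm_J_diff_power2_le:
  assumes "0 \<le> s" "s \<le> t"
  shows "(norm (J s x - J t x))\<^sup>2 \<le> (norm (J s x))\<^sup>2 - (norm (J t x))\<^sup>2"
proof -
  define w where "w = J s (J t x)"
  have "0 \<le> t" using assms by simp
  have Jt: "J t x = E s w" unfolding w_def E_J[OF assms(1)] ..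
  have Js: "J s x = E t w" unfolding w_def J_J[OF \<open>0 \<le> t\<close> assms(1)] E_J[OF \<open>0 \<le> t\<close>] ..
  have "J s x - J t x = (t - s) *\<^sub>R (w - T w)"
    unfolding Js Jt by (simp add: algebra_simps)
  then have "(norm (J s x - J t x))\<^sup>2 = (t - s)\<^sup>2 * (norm (w - T w))\<^sup>2"
    by (simp add: power_mult_distrib)
  also have "\<dots> \<le> (t\<^sup>2 - s\<^sup>2) * (norm (w - T w))\<^sup>2"
  proof (rule mult_right_mono)
    show "(t - s)\<^sup>2 \<le> t\<^sup>2 - s\<^sup>2"
      using mult_left_mono[OF assms(2,1)] by (simp add: power2_eq_square algebra_simps)
  qed simp
  also have "\<dots> \<le> (norm (E t w))\<^sup>2 - (norm (E s w))\<^sup>2"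
    using assms by (intro norm_add_scaleR_power2_diff_ge) (auto simp: norm_T_le)
  finally show ?thesis unfolding Js Jt .
qed

section \<open>Dyadic resolvent differences and their square function\<close>

definition D :: "nat \<Rightarrow> 'a \<Rightarrow> 'a"
  where "D j x = J (2 ^ j) x - J (2 ^ Suc j) x"

lemma square_function_D: "(\<Sum>j<N. (norm (D j x))\<^sup>2) \<le> (norm x)\<^sup>2"
proof -
  have "(\<Sum>j<N. (norm (D j x))\<^sup>2) \<le> (\<Sum>j<N. (norm (J (2 ^ j) x))\<^sup>2 - (norm (J (2 ^ Suc j) x))\<^sup>2)"
    unfolding D_def by (intro sum_mono norm_J_diff_power2_le) auto
  also have "\<dots> = (norm (J (2 ^ 0) x))\<^sup>2 - (norm (J (2 ^ N) x))\<^sup>2"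
    by (rule sum_lessThan_telescope')
  also have "\<dots> \<le> (norm (J 1 x))\<^sup>2" by simp
  also have "\<dots> \<le> (norm x)\<^sup>2" by (intro power_mono norm_J_le) auto
  finally show ?thesis .
qed

text \<open>Write k = n q + (k mod n) and give each of the n factors \<open>E s\<close> its own T^q.
  Since \<open>E s\<close> T^q = T^q + s (T^q - T^(q+1)) and s \<le> k + 1 \<le> n (q + 1), the Ritt
  bound makes each pair at most 1 + c n in norm.\<close>

lemma norm_funpow_E_funpow_T_le:
  assumes ritt: "\<And>q x. norm ((T ^^ q) x - (T ^^ Suc q) x) \<le> c / (real q + 1) * norm x"
    and "0 \<le> c" "0 < n" "0 \<le> s" "s \<le> real k + 1"
  shows "norm ((E s ^^ n) ((T ^^ k) x)) \<le> (1 + c * real n) ^ n * norm x"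
proof -
  define q where "q = k div n"
  have "k < n * (q + 1)"
    unfolding q_def using dividend_less_times_div[of n k] assms(3) by simp
  then have "real (k + 1) \<le> real (n * (q + 1))"
    by (subst of_nat_le_iff) simp
  then have q: "s \<le> real n * (real q + 1)"
    using assms(5) by (simp add: distrib_left)
  have one: "norm (E s ((T ^^ q) y)) \<le> (1 + c * real n) * norm y" for y
  proof -
    have "norm (E s ((T ^^ q) y)) \<le> norm ((T ^^ q) y) + s * norm ((T ^^ q) y - (T ^^ Suc q) y)"
      using norm_triangle_ineq[of "(T ^^ q) y" "s *\<^sub>R ((T ^^ q) y - (T ^^ Suc q) y)"] assms(4) by simp
    also have "\<dots> \<le> norm y + s * (c / (real q + 1) * norm y)"
      using assms(4) by (intro add_mono norm_funpow_T_le mult_left_mono ritt)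
    also have "\<dots> \<le> norm y + (real n * (real q + 1)) * (c / (real q + 1) * norm y)"
      using assms(2) q by (intro add_mono mult_right_mono) auto
    also have "\<dots> = (1 + c * real n) * norm y"
      by (simp add: field_simps)
    finally show ?thesis .
  qed
  have "norm ((E s ^^ p) ((T ^^ (p * q)) y)) \<le> (1 + c * real n) ^ p * norm y" for p y
  proof (induction p arbitrary: y)
    case (Suc p)
    have "E s ((T ^^ (p * q)) z) = (T ^^ (p * q)) (E s z)" for z
      by (intro funpow_commute(1)[symmetric] E_T)
    then have "(E s ^^ Suc p) ((T ^^ (Suc p * q)) y) = (E s ^^ p) ((T ^^ (p * q)) (E s ((T ^^ q) y)))"
      by (simp only: funpow_Suc_right comp_apply mult_Suc add.commute[of q] funpow_add)
    also have "norm \<dots> \<le> (1 + c * real n) ^ p * norm (E s ((T ^^ q) y))"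
      by (rule Suc.IH)
    also have "\<dots> \<le> (1 + c * real n) ^ p * ((1 + c * real n) * norm y)"
      using assms(2) by (intro mult_left_mono one) auto
    finally show ?case by (simp add: ac_simps)
  qed simp
  from this[of n "(T ^^ (k mod n)) x"]
  have "norm ((E s ^^ n) ((T ^^ (n * q + k mod n)) x)) \<le> (1 + c * real n) ^ n * norm ((T ^^ (k mod n)) x)"
    by (simp only: funpow_add comp_apply)
  also have "n * q + k mod n = k" unfolding q_def by simp
  also have "(1 + c * real n) ^ n * norm ((T ^^ (k mod n)) x) \<le> (1 + c * real n) ^ n * norm x"
    using assms(2) by (intro mult_left_mono norm_funpow_T_le) auto
  finally show ?thesis .
qed

text \<open>The powers J^(2m+2) are telescoped along the scales from i to N; the last term gives the
  remainder with q^N. The exponent is chosen so that each product in a difference contains m + 1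
  equal resolvents, to which \<open>CJ\<close> applies.\<close>

lemma norm_C_funpow_J_le:
  fixes C :: "'a \<Rightarrow> 'b::real_normed_vector"
  assumes C: "bounded_linear C"
    and CJ: "\<And>j x. norm (C ((J (2 ^ j) ^^ Suc m) x)) \<le> K * q ^ j * norm x"
    and K: "0 \<le> K" and q: "0 \<le> q" "q \<le> 1" and "i \<le> N"
  shows "norm (C ((J (2 ^ i) ^^ (2 * m + 2)) y)) \<le>
    real (2 * m + 2) * K * (\<Sum>j=i..<N. q ^ j * norm (D j y)) + K * q ^ N * norm y"
proof -
  let ?n = "2 * m + 2"
  have lin: "linear (J (2 ^ j))" for j
    by (intro bounded_linear.linear bounded_linear_J) simp
  have contr: "norm ((J (2 ^ j) ^^ l) z) \<le> norm z" for j l z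
    by (intro funpow_nonexpansive norm_J_le) simp
  have big: "norm (C ((J (2 ^ j) ^^ l) z)) \<le> K * q ^ j * norm z" if "m < l" for j l z
  proof -
    have "l = Suc m + (l - Suc m)" using that by simp
    then have "(J (2 ^ j) ^^ l) z = (J (2 ^ j) ^^ Suc m) ((J (2 ^ j) ^^ (l - Suc m)) z)"
      by (metis funpow_add comp_apply)
    also have "norm (C \<dots>) \<le> K * q ^ j * norm ((J (2 ^ j) ^^ (l - Suc m)) z)"
      by (rule CJ)
    also have "\<dots> \<le> K * q ^ j * norm z"
      using K q by (intro mult_left_mono contr) auto
    finally show ?thesis .
  qed
  \<comment> \<open>Of the 2m + 1 resolvents, either l \<ge> m + 1 belong to scale j, or 2m + 1 - l
    \<ge> m + 1 belong to scale j + 1. The larger group is moved next to C, and q^(j+1) \<le> q^j in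
    the second case.\<close>
  have mixed: "norm (C ((J (2 ^ j) ^^ l) ((J (2 ^ Suc j) ^^ (?n - 1 - l)) z))) \<le> K * q ^ j * norm z"
    if "l < ?n" for j l z
  proof (cases "m < l")
    case True
    have "norm (C ((J (2 ^ j) ^^ l) ((J (2 ^ Suc j) ^^ (?n - 1 - l)) z))) \<le>
        K * q ^ j * norm ((J (2 ^ Suc j) ^^ (?n - 1 - l)) z)"
      by (rule big[OF True])
    also have "\<dots> \<le> K * q ^ j * norm z"
      using K q by (intro mult_left_mono contr) auto
    finally show ?thesis .
  next
    case False
    have "(J (2 ^ j) ^^ l) ((J (2 ^ Suc j) ^^ (?n - 1 - l)) z) =
        (J (2 ^ Suc j) ^^ (?n - 1 - l)) ((J (2 ^ j) ^^ l) z)"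
      by (intro funpow_commute(2) J_J) auto
    also have "norm (C \<dots>) \<le> K * q ^ Suc j * norm ((J (2 ^ j) ^^ l) z)"
      using False by (intro big) auto
    also have "\<dots> \<le> K * q ^ j * norm z"
      using K q by (intro mult_mono contr mult_left_mono power_decreasing) auto
    finally show ?thesis .
  qed
  have step: "norm (C ((J (2 ^ j) ^^ ?n) y) - C ((J (2 ^ Suc j) ^^ ?n) y)) \<le>
      real ?n * K * (q ^ j * norm (D j y))" for j
  proof -
    have "(J (2 ^ j) ^^ ?n) y - (J (2 ^ Suc j) ^^ ?n) y =
        (\<Sum>l<?n. (J (2 ^ j) ^^ l) ((J (2 ^ Suc j) ^^ (?n - 1 - l)) (D j y)))"
      unfolding D_def by (intro funpow_diff_telescope lin J_J) auto
    then have "C ((J (2 ^ j) ^^ ?n) y) - C ((J (2 ^ Suc j) ^^ ?n) y) =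
        (\<Sum>l<?n. C ((J (2 ^ j) ^^ l) ((J (2 ^ Suc j) ^^ (?n - 1 - l)) (D j y))))"
      by (metis (no_types) linear_diff[OF bounded_linear.linear[OF C]] linear_sum[OF bounded_linear.linear[OF C]])
    also have "norm \<dots> \<le> (\<Sum>l<?n. K * q ^ j * norm (D j y))"
      by (intro sum_norm_le mixed) simp
    finally show ?thesis by (simp add: ac_simps)
  qed
  have "C ((J (2 ^ i) ^^ ?n) y) =
      (\<Sum>j=i..<N. C ((J (2 ^ j) ^^ ?n) y) - C ((J (2 ^ Suc j) ^^ ?n) y)) + C ((J (2 ^ N) ^^ ?n) y)"
    using sum_Suc_diff'[OF \<open>i \<le> N\<close>, of "\<lambda>j. - C ((J (2 ^ j) ^^ ?n) y)"] by simp
  also have "norm \<dots> \<le> (\<Sum>j=i..<N. real ?n * K * (q ^ j * norm (D j y))) + K * q ^ N * norm y"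
    by (intro norm_triangle_le add_mono sum_norm_le step big) simp
  finally show ?thesis by (simp add: sum_distrib_left)
qed

text \<open>T^k x is recovered from \<open>?G x\<close> by the n-th power of the resolvent at scale
  i. As \<open>?G\<close> commutes with every \<open>D j\<close>, its uniform bound
  \<open>?L\<close> can be taken out of each term, leaving the differences of x itself.\<close>

lemma norm_C_funpow_T_le:
  fixes C :: "'a \<Rightarrow> 'b::real_normed_vector"
  assumes C: "bounded_linear C"
    and CJ: "\<And>j x. norm (C ((J (2 ^ j) ^^ Suc m) x)) \<le> K * q ^ j * norm x"
    and K: "0 \<le> K" and q: "0 \<le> q" "q \<le> 1"
    and ritt: "\<And>q x. norm ((T ^^ q) x - (T ^^ Suc q) x) \<le> c / (real q + 1) * norm x" and c: "0 \<le> c"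
    and i: "2 ^ i \<le> real k + 1" "i \<le> N"
  defines "B \<equiv> real (2 * m + 2) * K * (1 + c * real (2 * m + 2)) ^ (2 * m + 2)"
  shows "norm (C ((T ^^ k) x)) \<le> B * (\<Sum>j=i..<N. q ^ j * norm (D j x)) + B * q ^ N * norm x"
proof -
  let ?n = "2 * m + 2"
  let ?L = "(1 + c * real ?n) ^ ?n"
  let ?G = "\<lambda>x. (E (2 ^ i) ^^ ?n) ((T ^^ k) x)"
  have G: "norm (?G z) \<le> ?L * norm z" for z
    by (intro norm_funpow_E_funpow_T_le ritt c i) auto
  have JE: "(J (2 ^ i) ^^ n) ((E (2 ^ i) ^^ n) z) = z" for n z
  proof (induction n arbitrary: z)
    case (Suc n)
    have "(J (2 ^ i) ^^ Suc n) ((E (2 ^ i) ^^ Suc n) z) =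
        (J (2 ^ i) ^^ n) (J (2 ^ i) (E (2 ^ i) ((E (2 ^ i) ^^ n) z)))"
      by (simp only: funpow_Suc_right[of n "J (2 ^ i)"] funpow.simps(2)[of n "E (2 ^ i)"] comp_apply)
    also have "J (2 ^ i) (E (2 ^ i) ((E (2 ^ i) ^^ n) z)) = (E (2 ^ i) ^^ n) z"
      by (intro J_E) simp
    finally show ?case using Suc.IH by simp
  qed simp
  have GJ: "?G (J (2 ^ j) z) = J (2 ^ j) (?G z)" for j z
  proof -
    have "(T ^^ k) (J (2 ^ j) z) = J (2 ^ j) ((T ^^ k) z)"
      by (intro funpow_commute(1) T_J) simp
    moreover have "(E (2 ^ i) ^^ ?n) (J (2 ^ j) ((T ^^ k) z)) = J (2 ^ j) (?G z)"
      by (intro funpow_commute(1) E_J_commute) simp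
    ultimately show ?thesis by simp
  qed
  have linG: "linear ?G"
  proof -
    have "bounded_linear (E (2 ^ i))"
      by (intro bounded_linear_add bounded_linear_ident bounded_linear_sub
        bounded_linear_T bounded_linear_compose[OF bounded_linear_scaleR_right])
    then show ?thesis
      by (intro bounded_linear.linear bounded_linear_compose[OF bounded_linear_funpow] bounded_linear_funpow
          bounded_linear_T)
  qed
  have GD: "D j (?G x) = ?G (D j x)" for j
    unfolding D_def linear_diff[OF linG] GJ ..
  have "norm (C ((T ^^ k) x)) = norm (C ((J (2 ^ i) ^^ ?n) (?G x)))"
    by (simp only: JE)
  also have "\<dots> \<le> real ?n * K * (\<Sum>j=i..<N. q ^ j * norm (?G (D j x))) + K * q ^ N * norm (?G x)"
    using norm_C_funpow_J_le[OF C CJ K q i(2), of "?G x"] unfolding GD .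
  also have "\<dots> \<le> real ?n * K * (\<Sum>j=i..<N. q ^ j * (?L * norm (D j x))) + K * q ^ N * (?L * norm x)"
    using K q by (intro add_mono mult_left_mono sum_mono G) auto
  also have "\<dots> = B * (\<Sum>j=i..<N. q ^ j * norm (D j x)) + K * ?L * (q ^ N * norm x)"
  proof -
    have "(\<Sum>j=i..<N. q ^ j * (?L * norm (D j x))) = ?L * (\<Sum>j=i..<N. q ^ j * norm (D j x))"
      by (simp only: sum_distrib_left mult.left_commute)
    then show ?thesis by (simp only: B_def ac_simps)
  qed
  \<comment> \<open>The remainder lacks the factor 2m + 2 \<ge> 1; enlarging it lets one constant
    \<open>B\<close> serve both terms.\<close>
  also have "K * ?L * (q ^ N * norm x) \<le> B * (q ^ N * norm x)"
  proof (rule mult_right_mono)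
    have "1 * (K * ?L) \<le> real ?n * (K * ?L)"
      using K c by (intro mult_right_mono mult_nonneg_nonneg zero_le_power) auto
    then show "K * ?L \<le> B" by (simp add: B_def ac_simps)
  qed (use q in auto)
  finally show ?thesis by (simp add: ac_simps)
qed

section \<open>The two implications\<close>

lemma resolvent_bound_if_admissible:
  fixes C :: "'a \<Rightarrow> 'b::complex_banach"
  assumes C: "bounded_clinear C" and adm: "admissible \<alpha> T C"
    and "-1 < \<beta>" and m: "real m = (\<alpha> + \<beta>) / 2"
  obtains K where "K \<ge> 0" and "\<And>\<omega>. cmod \<omega> < 1 \<Longrightarrow>
    (1 - (cmod \<omega>)\<^sup>2) powr ((1 + \<beta>) / 2) * onorm (C \<circ> (resolvent_inv T \<omega> ^^ (m + 1))) \<le> K"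
proof -
  from adm obtain M where "M \<ge> 0"
    and sm: "\<And>x. summable (\<lambda>k. (real k + 1) powr \<alpha> * (norm (C ((T ^^ k) x)))\<^sup>2)"
    and M: "\<And>x. (\<Sum>k. (real k + 1) powr \<alpha> * (norm (C ((T ^^ k) x)))\<^sup>2) \<le> M\<^sup>2 * (norm x)\<^sup>2"
    unfolding admissible_def by blast
  obtain c where "c > 0"
    and smc: "\<And>r. 0 \<le> r \<Longrightarrow> r < 1 \<Longrightarrow> summable (\<lambda>k. (real k + 1) powr \<beta> * r ^ k)"
    and c: "\<And>r. 0 \<le> r \<Longrightarrow> r < 1 \<Longrightarrow>
      (\<Sum>k. (real k + 1) powr \<beta> * r ^ k) \<le> c * (1 - r) powr (- (\<beta> + 1))"
    by (rule powr_geometric_suminf_bound[OF \<open>-1 < \<beta>\<close>]) (rule that)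
  have blC: "bounded_linear C" and C_scaleC: "\<And>c x. C (c *\<^sub>C x) = c *\<^sub>C C x"
    using C by (auto simp: bounded_clinear_def)
  have "(1 - (cmod \<omega>)\<^sup>2) powr ((1 + \<beta>) / 2) * onorm (C \<circ> (resolvent_inv T \<omega> ^^ (m + 1))) \<le> sqrt c * M"
    if \<omega>: "cmod \<omega> < 1" for \<omega>
  proof -
    let ?r = "(cmod \<omega>)\<^sup>2"
    have r: "0 \<le> ?r" "?r < 1"
      using \<omega> by (auto simp: power_less_one_iff abs_square_less_1)
    \<comment> \<open>\<open>e\<close> is the weight in the claimed bound, and its inverse square is
      the growth of the \<beta>-weighted geometric series at r = |\<omega>|^2.\<close>
    define e where "e = (1 - ?r) powr ((1 + \<beta>) / 2)"
    have "e > 0" unfolding e_def using r by simp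
    have e2: "(1 - ?r) powr (- (\<beta> + 1)) = (1 / e)\<^sup>2"
    proof -
      have "e * e = (1 - ?r) powr (\<beta> + 1)"
        unfolding e_def powr_add[symmetric] by (simp add: add.commute)
      from this[symmetric] show ?thesis
        unfolding powr_minus by (simp add: power2_eq_square divide_inverse)
    qed
    have "norm (C (suminf (neumann m \<omega> x))) \<le> sqrt c * M / e * norm x" for x
    proof -
      \<comment> \<open>As m = \<beta> / 2 + \<alpha> / 2, the weight (k + 1)^m splits into a scalar
        part \<open>u\<close>, summed by the geometric bound, and a part \<open>w\<close>, summed by
        admissibility. Cauchy-Schwarz is applied to partial sums, and the limit is taken
        afterwards.\<close>
      define u where "u k = (real k + 1) powr (\<beta> / 2) * cmod \<omega> ^ k" for k
      define w where "w k = (real k + 1) powr (\<alpha> / 2) * norm (C ((T ^^ k) x))" for k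
      have u2: "(u k)\<^sup>2 = (real k + 1) powr \<beta> * ?r ^ k" for k
        unfolding u_def power_mult_distrib
        by (simp add: power2_eq_square powr_add[symmetric] power_mult_distrib)
      have w2: "(w k)\<^sup>2 = (real k + 1) powr \<alpha> * (norm (C ((T ^^ k) x)))\<^sup>2" for k
        unfolding w_def power_mult_distrib
        by (simp add: power2_eq_square powr_add[symmetric])
      have term_le: "norm (C (neumann m \<omega> x k)) \<le> u k * w k" for k
      proof -
        have "norm (C (neumann m \<omega> x k)) = real (k + m choose m) * cmod \<omega> ^ k * norm (C ((T ^^ k) x))"
          by (simp add: neumann_def C_scaleC norm_scaleC norm_mult norm_power)
        also have "\<dots> \<le> (real k + 1) powr real m * cmod \<omega> ^ k * norm (C ((T ^^ k) x))"
          by (intro mult_right_mono binomial_le_powr) auto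
        also have "(real k + 1) powr real m = (real k + 1) powr (\<beta> / 2) * (real k + 1) powr (\<alpha> / 2)"
          unfolding m powr_add[symmetric] by (simp add: add_divide_distrib add.commute)
        finally show ?thesis by (simp add: u_def w_def ac_simps)
      qed
      have "norm (\<Sum>k<n. C (neumann m \<omega> x k)) \<le> sqrt c * M / e * norm x" for n
      proof -
        have "(\<Sum>k<n. (u k)\<^sup>2) \<le> (\<Sum>k. (u k)\<^sup>2)"
          unfolding u2 using r smc by (intro sum_le_suminf) auto
        also have "\<dots> \<le> c * (1 / e)\<^sup>2"
          unfolding u2 e2[symmetric] by (rule c[OF r])
        finally have U: "(\<Sum>k<n. (u k)\<^sup>2) \<le> c * (1 / e)\<^sup>2" .
        have "(\<Sum>k<n. (w k)\<^sup>2) \<le> (\<Sum>k. (w k)\<^sup>2)"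
          unfolding w2 using sm by (intro sum_le_suminf) auto
        also have "\<dots> \<le> M\<^sup>2 * (norm x)\<^sup>2"
          unfolding w2 by (rule M)
        finally have W: "(\<Sum>k<n. (w k)\<^sup>2) \<le> M\<^sup>2 * (norm x)\<^sup>2" .
        have "(\<Sum>k<n. u k * w k)\<^sup>2 \<le> (\<Sum>k<n. (u k)\<^sup>2) * (\<Sum>k<n. (w k)\<^sup>2)"
          by (rule Cauchy_Schwarz_ineq_sum)
        also have "\<dots> \<le> (c * (1 / e)\<^sup>2) * (M\<^sup>2 * (norm x)\<^sup>2)"
          using \<open>c > 0\<close> by (intro mult_mono U W sum_nonneg) auto
        also have "\<dots> = (sqrt c * M / e * norm x)\<^sup>2"
          using \<open>c > 0\<close> by (simp add: power_mult_distrib power_divide)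
        finally have "(\<Sum>k<n. u k * w k) \<le> sqrt c * M / e * norm x"
          by (rule power2_le_imp_le) (use \<open>M \<ge> 0\<close> \<open>e > 0\<close> \<open>c > 0\<close> in auto)
        moreover have "norm (\<Sum>k<n. C (neumann m \<omega> x k)) \<le> (\<Sum>k<n. u k * w k)"
          by (intro sum_norm_le term_le)
        ultimately show ?thesis by simp
      qed
      moreover have "(\<lambda>n. \<Sum>k<n. C (neumann m \<omega> x k)) \<longlonglongrightarrow> C (suminf (neumann m \<omega> x))"
        using bounded_linear.sums[OF blC summable_sums[OF summable_neumann[OF \<omega>]]]
        by (simp add: sums_def)
      ultimately show ?thesis
        by (intro Lim_bounded[OF tendsto_norm]) auto
    qed
    then have "onorm (C \<circ> (resolvent_inv T \<omega> ^^ (m + 1))) \<le> sqrt c * M / e"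
      using \<open>M \<ge> 0\<close> \<open>e > 0\<close> \<open>c > 0\<close> funpow_resolvent_eq_suminf_neumann[OF \<omega>, of m]
      by (intro onorm_bound) (auto simp del: funpow.simps)
    then show ?thesis
      using \<open>e > 0\<close> unfolding e_def[symmetric] by (simp add: field_simps)
  qed
  with \<open>M \<ge> 0\<close> \<open>c > 0\<close> show thesis by (intro that[of "sqrt c * M"]) auto
qed

text \<open>The hypothesis is tested at \<omega> = s / (1 + s) with s = 2^j, which turns it into
  decay of C J^(m+1) at scale j; the dyadic estimates then bound all partial sums of the
  admissibility series.\<close>

lemma admissible_if_resolvent_bound:
  fixes C :: "'a \<Rightarrow> 'b::complex_banach"
  assumes C: "bounded_clinear C" and "Ritt T"
    and \<alpha>: "\<alpha> > -1" and \<beta>: "-1 < \<beta>" and m: "real m = (\<alpha> + \<beta>) / 2"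
    and K: "K \<ge> 0" and resolvent: "\<And>\<omega>. cmod \<omega> < 1 \<Longrightarrow>
      (1 - (cmod \<omega>)\<^sup>2) powr ((1 + \<beta>) / 2) * onorm (C \<circ> (resolvent_inv T \<omega> ^^ (m + 1))) \<le> K"
  shows "admissible \<alpha> T C"
proof -
  from \<open>Ritt T\<close> obtain c where c: "c \<ge> 0"
    and ritt0: "\<And>k. k \<ge> 1 \<Longrightarrow> real k * onorm (\<lambda>x. (T ^^ k) x - (T ^^ (k - 1)) x) \<le> c"
    unfolding Ritt_def by blast
  have ritt: "norm ((T ^^ q) x - (T ^^ Suc q) x) \<le> c / (real q + 1) * norm x" for q x
  proof -
    have bl: "bounded_linear (\<lambda>x. (T ^^ Suc q) x - (T ^^ q) x)"
      by (intro bounded_linear_sub bounded_linear_funpow bounded_linear_T)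
    have "onorm (\<lambda>x. (T ^^ Suc q) x - (T ^^ q) x) \<le> c / (real q + 1)"
      using ritt0[of "Suc q"] by (simp add: pos_le_divide_eq mult.commute add.commute del: funpow.simps)
    then have "norm ((T ^^ Suc q) x - (T ^^ q) x) \<le> c / (real q + 1) * norm x"
      using onorm[OF bl, of x] by (meson mult_right_mono norm_ge_zero order_trans)
    then show ?thesis by (simp only: norm_minus_commute)
  qed
  have blC: "bounded_linear C"
    using C by (simp add: bounded_clinear_def)
  define q :: real where "q = 2 powr (- (1 + \<alpha>) / 2)"
  have q: "0 \<le> q" "q \<le> 1"
    unfolding q_def using \<alpha> powr_less_one[of 2 "- (1 + \<alpha>) / 2"] by auto
  have CJ: "norm (C ((J (2 ^ j) ^^ Suc m) x)) \<le> K * q ^ j * norm x" for j x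
  proof -
    define s :: real where "s = 2 ^ j"
    have "s > 0" by (simp add: s_def)
    define \<omega> where "\<omega> = complex_of_real (s / (1 + s))"
    have \<omega>: "cmod \<omega> = s / (1 + s)" "cmod \<omega> < 1"
      unfolding \<omega>_def using \<open>s > 0\<close> by (auto simp only: cmod_J_point less_imp_le) simp_all
    define N where "N = onorm (C \<circ> (resolvent_inv T \<omega> ^^ (m + 1)))"
    have bl: "bounded_linear (C \<circ> (resolvent_inv T \<omega> ^^ (m + 1)))"
      unfolding comp_def
      by (intro bounded_linear_compose[OF blC] bounded_linear_funpow bounded_linear_resolvent \<omega>(2))
    have "N \<ge> 0" unfolding N_def by (rule onorm_pos_le[OF bl])
    \<comment> \<open>Since |\<omega>|^2 \<le> |\<omega>|, the weight at this point is controlled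
      from below by 1 - |\<omega>| = 1 / (1 + s).\<close>
    have "1 / (1 + s) \<le> 1 - (cmod \<omega>)\<^sup>2"
    proof -
      have "(cmod \<omega>)\<^sup>2 \<le> cmod \<omega>"
        using \<omega>(2) by (simp add: power2_eq_square mult_left_le)
      moreover have "1 - cmod \<omega> = 1 / (1 + s)"
        using \<open>s > 0\<close> by (simp add: \<omega>(1) field_simps)
      ultimately show ?thesis by simp
    qed
    then have "(1 / (1 + s)) powr ((1 + \<beta>) / 2) * N \<le> (1 - (cmod \<omega>)\<^sup>2) powr ((1 + \<beta>) / 2) * N"
      using \<open>s > 0\<close> \<beta> \<open>N \<ge> 0\<close> by (intro mult_right_mono powr_mono2) auto
    also have "\<dots> \<le> K" unfolding N_def by (rule resolvent[OF \<omega>(2)])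
    finally have NK: "(1 / (1 + s)) powr ((1 + \<beta>) / 2) * N \<le> K" .
    \<comment> \<open>The normalising factor of J^(m+1) has exponent m + 1 = (1 + \<alpha>) / 2 + (1
      + \<beta>) / 2. The \<beta> part is absorbed by the resolvent bound; the \<alpha> part is at
      most s powr (-(1 + \<alpha>) / 2) = q^j.\<close>
    have exps: "(1 / (1 + s)) ^ Suc m = (1 / (1 + s)) powr ((1 + \<alpha>) / 2) * (1 / (1 + s)) powr ((1 + \<beta>) / 2)"
    proof -
      have "(1 / (1 + s)) ^ Suc m = (1 / (1 + s)) powr real (Suc m)"
        using \<open>s > 0\<close> by (intro powr_realpow[symmetric]) simp
      also have "real (Suc m) = (1 + \<alpha>) / 2 + (1 + \<beta>) / 2"
        using m by (simp add: field_simps)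
      finally show ?thesis by (simp only: powr_add)
    qed
    have "(1 / (1 + s)) powr ((1 + \<alpha>) / 2) \<le> (1 / s) powr ((1 + \<alpha>) / 2)"
      using \<open>s > 0\<close> \<alpha> by (intro powr_mono2) (auto simp: field_simps)
    also have "\<dots> = q ^ j"
    proof -
      have "1 / s = 2 powr (- real j)"
        by (simp add: s_def powr_minus powr_realpow divide_inverse)
      then show ?thesis
        unfolding q_def by (simp add: powr_powr powr_power field_simps)
    qed
    finally have sq: "(1 / (1 + s)) powr ((1 + \<alpha>) / 2) \<le> q ^ j" .
    have "C ((J s ^^ Suc m) x) = (1 / (1 + s)) ^ Suc m *\<^sub>R (C \<circ> (resolvent_inv T \<omega> ^^ (m + 1))) x"
      using \<open>s > 0\<close> unfolding \<omega>_def
      by (simp only: funpow_J less_imp_le linear_scale[OF bounded_linear.linear[OF blC]] comp_apply Suc_eq_plus1)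
    then have "norm (C ((J s ^^ Suc m) x)) = (1 / (1 + s)) ^ Suc m * norm ((C \<circ> (resolvent_inv T \<omega> ^^ (m + 1))) x)"
      using \<open>s > 0\<close> by (simp only: norm_scaleR) simp
    also have "\<dots> \<le> (1 / (1 + s)) ^ Suc m * (N * norm x)"
      unfolding N_def using \<open>s > 0\<close> by (intro mult_left_mono onorm[OF bl]) auto
    also have "\<dots> = (1 / (1 + s)) powr ((1 + \<alpha>) / 2) * ((1 / (1 + s)) powr ((1 + \<beta>) / 2) * N) * norm x"
      unfolding exps by (simp only: ac_simps)
    also have "\<dots> \<le> q ^ j * K * norm x"
      using \<open>N \<ge> 0\<close> q by (intro mult_right_mono mult_mono sq NK) auto
    finally show ?thesis unfolding s_def by (simp only: ac_simps)
  qed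
  define B where "B = real (2 * m + 2) * K * (1 + c * real (2 * m + 2)) ^ (2 * m + 2)"
  \<comment> \<open>The square root of the constant in \<open>dyadic_weighted_sum_bound\<close>
    after the squared norm of x has been taken out.\<close>
  define M where "M = sqrt (2 powr \<bar>\<alpha>\<bar> * (2 * B\<^sup>2) / (1 - q)\<^sup>2)"
  have bound: "(\<Sum>k<n. (real k + 1) powr \<alpha> * (norm (C ((T ^^ k) x)))\<^sup>2) \<le> M\<^sup>2 * (norm x)\<^sup>2" for n x
  proof -
    have "(\<Sum>k<n. (real k + 1) powr \<alpha> * (norm (C ((T ^^ k) x)))\<^sup>2) \<le>
        2 powr \<bar>\<alpha>\<bar> * (2 * B\<^sup>2) * ((norm x)\<^sup>2 / (1 - q)\<^sup>2)"
      unfolding q_def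
    proof (rule dyadic_weighted_sum_bound[OF \<alpha> square_function_D[where x = x]])
      show "norm (C ((T ^^ k) x)) \<le> B * (\<Sum>j=i..<N. (2 powr (- (1 + \<alpha>) / 2)) ^ j * norm (D j x)) +
          B * (2 powr (- (1 + \<alpha>) / 2)) ^ N * norm x" if "2 ^ i \<le> real k + 1" "i \<le> N" for k i N
        using norm_C_funpow_T_le[OF blC CJ K q ritt c that] unfolding B_def q_def .
    qed simp
    then show ?thesis by (simp add: M_def)
  qed
  show ?thesis
    unfolding admissible_def
  proof (intro exI[of _ M] conjI allI)
    show "M \<ge> 0" by (simp add: M_def)
    fix x
    show sm: "summable (\<lambda>k. (real k + 1) powr \<alpha> * (norm (C ((T ^^ k) x)))\<^sup>2)"
      by (rule summableI_nonneg_bounded[OF _ bound]) simp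
    show "(\<Sum>k. (real k + 1) powr \<alpha> * (norm (C ((T ^^ k) x)))\<^sup>2) \<le> M\<^sup>2 * (norm x)\<^sup>2"
      by (rule suminf_le_const[OF sm bound])
  qed
qed

end

theorem corollary3p4:
  fixes T :: "'a::complex_hilbert \<Rightarrow> 'a"
    and C :: "'a \<Rightarrow> 'b::complex_banach"
    and \<alpha> \<beta> :: real and m :: nat
  assumes "bounded_clinear T" and "onorm T \<le> 1" and "Ritt T"
    and "\<alpha> > -1" and "-1 < \<beta>" and "\<beta> < 3"
    and "real m = (\<alpha> + \<beta>) / 2"
    and "bounded_clinear C"
  shows "admissible \<alpha> T C \<longleftrightarrow>
    (\<exists>K\<ge>0. \<forall>\<omega>::complex. cmod \<omega> < 1 \<longrightarrow>
      (1 - (cmod \<omega>)\<^sup>2) powr ((1 + \<beta>) / 2) * onorm (C \<circ> (resolvent_inv T \<omega> ^^ (m + 1))) \<le> K)"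
proof -
  interpret hilbert_contraction T
    by unfold_locales (use assms in auto)
  show ?thesis (is "_ \<longleftrightarrow> ?bound")
  proof
    assume "admissible \<alpha> T C"
    then show ?bound
      by (rule resolvent_bound_if_admissible[OF assms(8) _ assms(5,7)]) blast
  next
    assume ?bound
    then obtain K where "K \<ge> 0" and "\<And>\<omega>. cmod \<omega> < 1 \<Longrightarrow>
        (1 - (cmod \<omega>)\<^sup>2) powr ((1 + \<beta>) / 2) * onorm (C \<circ> (resolvent_inv T \<omega> ^^ (m + 1))) \<le> K"
      by blast
    then show "admissible \<alpha> T C"
      by (rule admissible_if_resolvent_bound[OF assms(8,3,4,5,7)])
  qed
qed

end
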